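(* Let $V$ be a finite set of agents with $|V|=n$, $A$ a set of alternatives, $a,b$ two distinct elements of $A$, $\mathcal W\subseteq\mathcal W(A)$ and $\mathcal P=\mathcal W^V$. Assume that the set $\mathcal I=\{W\in\mathcal W: a\sim_W b\}$ is finite, with elements enumerated without repetition as $W_1,\dots,W_\tau$ ($\tau\ge 0$). Let $L=\{0,1,\dots,n\}^{\tau+1}$ be endowed with the partial order $\le_L$ defined below, and let $\chi:\mathcal P\to L$ be $$\chi(P)=\big(|D(a,P)|,|I_1(P)|,\dots,|I_\tau(P)|\big).$$ Let $\phi:\mathcal P\to\{a,b\}$ be a social choice function. Then $\phi$ is weakly group strategy-proof and anonymous if and only if $\phi$ is $(\chi,a)$-monotone, i.e. $$\big[P,Q\in\mathcal P,\ \chi(P)\ge_L\chi(Q),\ \phi(Q)=a\big]\Rightarrow\phi(P)=a.$$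
   Context: $\mathcal W(A)$ is the set of all complete, transitive binary relations (preferences) on $A$. For $W\in\mathcal W(A)$: $x\succsim_W y$ means $(x,y)\in W$; $x\succ_W y$ means $(x,y)\in W$ and $(y,x)\notin W$; $x\sim_W y$ means both $(x,y),(y,x)\in W$. The elements of $\mathcal P=\mathcal W^V$ are the feasible profiles $P=(P_v)_{v\in V}$. $A$ need not be finite. $D(a,P)=\{v\in V: a\succ_{P_v} b\}$ and $I_i(P)=\{v\in V: P_v=W_i\}$ for $i=1,\dots,\tau$. The partial order on $L=\{0,1,\dots,n\}^{\tau+1}$ is: for $k=(k_0,\dots,k_\tau)$ and $\ell=(\ell_0,\dots,\ell_\tau)$, $k\le_L\ell$ iff $\sum_{i=1}^\tau (k_i-\ell_i)^+\le \ell_0-k_0$, where $t^+=\max\{t,0\}$. A social choice function $\phi:\mathcal P\to A$ is weakly group strategy-proof if there are no nonempty $D\subseteq V$ and $P,Q\in\mathcal P$ such that $P_v=Q_v$ for all $v\in V\setminus D$ and $\phi(Q)\succ_{P_v}\phi(P)$ for all $v\in D$. It is anonymous if $\phi(P)=\phi(P\circ\sigma)$ for every $P\in\mathcal P$ and every permutation $\sigma$ of $V$, where $P\circ\sigma$ is the profile in which the preference of agent $v$ is $P_{\sigma(v)}$. *)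

theory Defs
  imports "HOL-Combinatorics.Permutations" "HOL-Library.FuncSet"
begin

text \<open>Completeness is required of all pairs, including \<open>x = y\<close>, hence it subsumes reflexivity
  on \<open>A\<close>.\<close>

definition preferences :: "'x set \<Rightarrow> 'x rel set" where
  "preferences A =
     {W. W \<subseteq> A \<times> A \<and> (\<forall>x\<in>A. \<forall>y\<in>A. (x, y) \<in> W \<or> (y, x) \<in> W) \<and> trans W}"

definition prefers :: "'x rel \<Rightarrow> 'x \<Rightarrow> 'x \<Rightarrow> bool" where
  "prefers W x y \<longleftrightarrow> (x, y) \<in> W \<and> (y, x) \<notin> W"

definition indifferent :: "'x rel \<Rightarrow> 'x \<Rightarrow> 'x \<Rightarrow> bool" where
  "indifferent W x y \<longleftrightarrow> (x, y) \<in> W \<and> (y, x) \<in> W"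

definition profiles :: "'v set \<Rightarrow> 'x rel set \<Rightarrow> ('v \<Rightarrow> 'x rel) set" where
  "profiles V \<W> = V \<rightarrow>\<^sub>E \<W>"

definition weakly_group_strategy_proof ::
  "'v set \<Rightarrow> 'x rel set \<Rightarrow> (('v \<Rightarrow> 'x rel) \<Rightarrow> 'x) \<Rightarrow> bool" where
  "weakly_group_strategy_proof V \<W> \<phi> \<longleftrightarrow>
     \<not> (\<exists>D P Q. D \<noteq> {} \<and> D \<subseteq> V \<and> P \<in> profiles V \<W> \<and> Q \<in> profiles V \<W> \<and>
            (\<forall>v\<in>V - D. P v = Q v) \<and> (\<forall>v\<in>D. prefers (P v) (\<phi> Q) (\<phi> P)))"

definition anonymous ::
  "'v set \<Rightarrow> 'x rel set \<Rightarrow> (('v \<Rightarrow> 'x rel) \<Rightarrow> 'x) \<Rightarrow> bool" where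
  "anonymous V \<W> \<phi> \<longleftrightarrow>
     (\<forall>P\<in>profiles V \<W>. \<forall>\<sigma>. \<sigma> permutes V \<longrightarrow> \<phi> P = \<phi> (P \<circ> \<sigma>))"

definition supporters :: "'v set \<Rightarrow> 'x \<Rightarrow> 'x \<Rightarrow> ('v \<Rightarrow> 'x rel) \<Rightarrow> 'v set" where
  "supporters V a b P = {v \<in> V. prefers (P v) a b}"

definition holders :: "'v set \<Rightarrow> 'x rel \<Rightarrow> ('v \<Rightarrow> 'x rel) \<Rightarrow> 'v set" where
  "holders V R P = {v \<in> V. P v = R}"

text \<open>Tuples \<open>(k\<^sub>0, \<dots>, k\<^sub>\<tau>)\<close> are extensional functions on \<open>{0..\<tau>}\<close>.\<close>

definition L_set :: "nat \<Rightarrow> nat \<Rightarrow> (nat \<Rightarrow> nat) set" where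
  "L_set n \<tau> = {0..\<tau>} \<rightarrow>\<^sub>E {0..n}"

text \<open>The differences are taken in the integers, since subtraction of naturals truncates.\<close>

definition L_order :: "nat \<Rightarrow> nat \<Rightarrow> (nat \<Rightarrow> nat) rel" where
  "L_order n \<tau> =
     {(k, l). k \<in> L_set n \<tau> \<and> l \<in> L_set n \<tau> \<and>
        (\<Sum>i = 1..\<tau>. max (int (k i) - int (l i)) 0) \<le> int (l 0) - int (k 0)}"

definition chi ::
  "'v set \<Rightarrow> 'x \<Rightarrow> 'x \<Rightarrow> nat \<Rightarrow> (nat \<Rightarrow> 'x rel) \<Rightarrow> ('v \<Rightarrow> 'x rel) \<Rightarrow> (nat \<Rightarrow> nat)" where
  "chi V a b \<tau> W P =
     (\<lambda>i\<in>{0..\<tau>}. if i = 0 then card (supporters V a b P) else card (holders V (W i) P))"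

text \<open>\<open>(\<chi>, a)\<close>-monotonicity on a set \<open>\<P>\<close> of profiles, where \<open>r\<close> is the order on the range
  of \<open>\<chi>\<close> and \<open>(k, l) \<in> r\<close> means \<open>k \<le> l\<close>.\<close>

definition chi_monotone :: "'p set \<Rightarrow> 'l rel \<Rightarrow> ('p \<Rightarrow> 'l) \<Rightarrow> 'x \<Rightarrow> ('p \<Rightarrow> 'x) \<Rightarrow> bool" where
  "chi_monotone \<P> r \<chi> a \<phi> \<longleftrightarrow>
     (\<forall>P\<in>\<P>. \<forall>Q\<in>\<P>. (\<chi> Q, \<chi> P) \<in> r \<and> \<phi> Q = a \<longrightarrow> \<phi> P = a)"

lemma chi_in_L_set:
  assumes "finite V" "card V = n"
  shows "chi V a b \<tau> W P \<in> L_set n \<tau>"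
  using assms
  by (auto simp: chi_def L_set_def supporters_def holders_def intro!: card_mono)

lemma comp_permutes_profiles:
  assumes "P \<in> profiles V \<W>" "\<sigma> permutes V"
  shows "P \<circ> \<sigma> \<in> profiles V \<W>"
  using assms
  by (auto simp: profiles_def PiE_def extensional_def permutes_in_image permutes_not_in)

lemma partial_order_L_order: "partial_order_on (L_set n \<tau>) (L_order n \<tau>)"
proof -
  have refl: "refl_on (L_set n \<tau>) (L_order n \<tau>)"
    by (auto simp: refl_on_def L_order_def)
  have trans: "trans (L_order n \<tau>)"
  proof (rule transI)
    fix k l m :: "nat \<Rightarrow> nat"
    assume kl: "(k, l) \<in> L_order n \<tau>" and lm: "(l, m) \<in> L_order n \<tau>"
    have "(\<Sum>i = 1..\<tau>. max (int (k i) - int (m i)) 0)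
        \<le> (\<Sum>i = 1..\<tau>. max (int (k i) - int (l i)) 0 + max (int (l i) - int (m i)) 0)"
      by (rule sum_mono) simp
    with kl lm show "(k, m) \<in> L_order n \<tau>"
      by (auto simp: L_order_def sum.distrib)
  qed
  have antisym: "antisym (L_order n \<tau>)"
  proof (rule antisymI)
    fix k l :: "nat \<Rightarrow> nat"
    assume kl: "(k, l) \<in> L_order n \<tau>" and lk: "(l, k) \<in> L_order n \<tau>"
    let ?s = "\<lambda>k l. \<Sum>i = 1..\<tau>. max (int (k i) - int (l i)) 0"
    have le: "?s k l \<le> int (l 0) - int (k 0)" "?s l k \<le> int (k 0) - int (l 0)"
      using kl lk by (auto simp: L_order_def)
    have ge: "?s k l \<ge> 0" "?s l k \<ge> 0"
      by (auto intro: sum_nonneg)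
    have z: "k 0 = l 0" "?s k l = 0" "?s l k = 0"
      using le ge by linarith+
    have "k i = l i" if "i \<in> {0..\<tau>}" for i
    proof (cases "i = 0")
      case False
      then have i: "i \<in> {1..\<tau>}" using that by auto
      have "\<forall>j\<in>{1..\<tau>}. max (int (k j) - int (l j)) 0 = 0"
        using z(2) by (subst (asm) sum_nonneg_eq_0_iff) auto
      moreover have "\<forall>j\<in>{1..\<tau>}. max (int (l j) - int (k j)) 0 = 0"
        using z(3) by (subst (asm) sum_nonneg_eq_0_iff) auto
      ultimately have "max (int (k i) - int (l i)) 0 = 0" "max (int (l i) - int (k i)) 0 = 0"
        using i by blast+
      then show ?thesis by linarith
    qed (use z(1) in simp)
    then show "k = l"
      using kl unfolding L_order_def L_set_def by (auto intro: PiE_ext)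
  qed
  show ?thesis
    using refl trans antisym
    by (auto simp: partial_order_on_def preorder_on_def L_order_def)
qed

end

theory Submission
  imports Defs
begin

text \<open>Say that \<open>P\<close> is shifted towards \<open>a\<close> from \<open>Q\<close> if passing from \<open>Q\<close> to \<open>P\<close> no supporter of \<open>a\<close>
  is lost and an indifferent agent changes only by becoming a supporter. Weak group
  strategy-proofness amounts to \<open>\<phi> Q = a \<Longrightarrow> \<phi> P = a\<close> along shifts: let first the
  agents who support \<open>a\<close> in \<open>P\<close> move, then the remaining movers, who all supported \<open>b\<close> in \<open>Q\<close>.
  On the other side, \<open>\<chi>(Q) \<le> \<chi>(P)\<close> holds exactly if, up to a permutation of the agents, \<open>P\<close> is
  shifted from \<open>Q\<close>: match as many holders of each \<open>W\<^sub>i\<close> in \<open>Q\<close> as possible with holders in \<open>P\<close>;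
  there are \<open>\<Sum>\<^sub>i (|I\<^sub>i(Q)| - |I\<^sub>i(P)|)\<^sup>+\<close> unmatched ones, and together with
  \<open>D(a,Q)\<close> they fit into \<open>D(a,P)\<close>.\<close>

section \<open>Matching agents by cardinality\<close>

lemma inj_on_extend_permutes:
  assumes "finite V" "S \<subseteq> V" "inj_on f S" "f ` S \<subseteq> V"
  obtains \<sigma> where "\<sigma> permutes V" "\<And>v. v \<in> S \<Longrightarrow> \<sigma> v = f v"
proof -
  have "card (V - S) = card (V - f ` S)"
    using assms by (simp add: card_Diff_subset finite_subset card_image)
  then obtain g where g: "bij_betw g (V - S) (V - f ` S)"
    using finite_same_card_bij assms(1) by blast
  \<comment> \<open>The identity outside \<open>V\<close> is what \<open>permutes\<close>
    demands.\<close>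
  define \<sigma> where "\<sigma> v = (if v \<in> S then f v else if v \<in> V then g v else v)" for v
  have "bij_betw \<sigma> S (f ` S)"
    using assms(3) by (auto simp: bij_betw_def \<sigma>_def inj_on_def)
  moreover have "bij_betw \<sigma> (V - S) (V - f ` S)"
    using g by (rule bij_betw_cong[THEN iffD1, rotated]) (auto simp: \<sigma>_def)
  ultimately have "bij_betw \<sigma> (S \<union> (V - S)) (f ` S \<union> (V - f ` S))"
    by (rule bij_betw_combine) blast
  moreover have "S \<union> (V - S) = V" "f ` S \<union> (V - f ` S) = V"
    using assms by blast+
  ultimately have "bij_betw \<sigma> V V" by simp
  then have "\<sigma> permutes V"
    by (rule bij_imp_permutes) (use assms(2) in \<open>auto simp: \<sigma>_def\<close>)
  then show thesis
    by (rule that) (simp add: \<sigma>_def)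
qed

lemma partial_injection:
  assumes "finite S" "finite T"
  obtains G g where "G \<subseteq> S" "inj_on g G" "g ` G \<subseteq> T" "card (S - G) = card S - card T"
proof -
  obtain G where G: "G \<subseteq> S" "card G = min (card S) (card T)"
    using obtain_subset_with_card_n[of "min (card S) (card T)" S] by auto
  moreover have "finite G"
    using G assms finite_subset by blast
  moreover obtain g where "g ` G \<subseteq> T" "inj_on g G"
    using card_le_inj[of G T] G \<open>finite G\<close> assms by auto
  ultimately show thesis
    by (intro that[of G g]) (auto simp: card_Diff_subset)
qed

text \<open>Labels stand for preferences: \<open>I\<close> for indifference between \<open>a\<close>
  and \<open>b\<close>, \<open>B\<close> for strict preference of \<open>a\<close>. Agents whose
  \<open>q\<close>-label lies in neither set are unconstrained, so it suffices to inject the others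
  into \<open>V\<close> and extend to a permutation. Truncated subtraction in \<open>le\<close> is
  the positive part.\<close>

lemma exists_label_matching:
  fixes p q :: "'v \<Rightarrow> 'c"
  assumes fin: "finite V" "finite I" and disj: "I \<inter> B = {}"
    and le: "(\<Sum>R\<in>I. card {v \<in> V. q v = R} - card {v \<in> V. p v = R}) + card {v \<in> V. q v \<in> B}
             \<le> card {v \<in> V. p v \<in> B}"
  obtains \<sigma> where "\<sigma> permutes V"
    "\<And>v. v \<in> V \<Longrightarrow> q v \<in> B \<Longrightarrow> p (\<sigma> v) \<in> B"
    "\<And>v. v \<in> V \<Longrightarrow> q v \<in> I \<Longrightarrow> p (\<sigma> v) = q v \<or> p (\<sigma> v) \<in> B"
proof -
  define S where "S R = {v \<in> V. q v = R}" for R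
  define T where "T R = {v \<in> V. p v = R}" for R
  have finST: "finite (S R)" "finite (T R)" for R
    using fin by (auto simp: S_def T_def)
  have "\<forall>R. \<exists>G g. G \<subseteq> S R \<and> inj_on g G \<and> g ` G \<subseteq> T R \<and> card (S R - G) = card (S R) - card (T R)"
    using partial_injection[OF finST] by metis
  then obtain G g where G: "\<And>R. G R \<subseteq> S R" "\<And>R. inj_on (g R) (G R)" "\<And>R. g R ` G R \<subseteq> T R"
      "\<And>R. card (S R - G R) = card (S R) - card (T R)"
    by metis
  \<comment> \<open>The agents that must be sent to a \<open>B\<close>-label: those left unmatched
    within their class and those already labelled in \<open>B\<close>. The pieces are disjoint, so
    \<open>le\<close> bounds their number.\<close>
  define rest where "rest = (\<Union>R\<in>I. S R - G R) \<union> {v \<in> V. q v \<in> B}"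
  have finrest: "finite rest"
    using fin finST by (auto simp: rest_def)
  have "card rest = card (\<Union>R\<in>I. S R - G R) + card {v \<in> V. q v \<in> B}"
    unfolding rest_def using fin finST disj
    by (intro card_Un_disjoint) (auto simp: S_def)
  also have "card (\<Union>R\<in>I. S R - G R) = (\<Sum>R\<in>I. card (S R - G R))"
    using fin finST by (intro card_UN_disjoint) (auto simp: S_def)
  also have "\<dots> = (\<Sum>R\<in>I. card (S R) - card (T R))"
    by (simp add: G)
  finally have "card rest \<le> card {v \<in> V. p v \<in> B}"
    using le by (simp add: S_def T_def)
  then obtain h where h: "h ` rest \<subseteq> {v \<in> V. p v \<in> B}" "inj_on h rest"
    using card_le_inj[OF finrest, of "{v \<in> V. p v \<in> B}"] fin(1) by auto
  define f where "f v = (if v \<in> rest then h v else g (q v) v)" for v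
  let ?U = "{v \<in> V. q v \<in> I \<union> B}"
  have in_rest: "f v \<in> V \<and> p (f v) \<in> B" if "v \<in> rest" for v
    using h that by (auto simp: f_def)
  have not_rest: "v \<in> G (q v) \<and> f v \<in> V \<and> p (f v) = q v \<and> q v \<in> I" if "v \<in> ?U" "v \<notin> rest" for v
  proof -
    have "v \<in> G (q v)" "q v \<in> I"
      using that by (auto simp: rest_def S_def)
    then show ?thesis
      using G(3)[of "q v"] that by (auto simp: f_def T_def)
  qed
  have "inj_on f ?U"
  proof (rule inj_onI)
    fix v w assume vw: "v \<in> ?U" "w \<in> ?U" "f v = f w"
    \<comment> \<open>Images of \<open>rest\<close> have \<open>p\<close>-label in \<open>B\<close>,
      all other images have it in \<open>I\<close>, so the two cannot collide.\<close>
    have iff: "v \<in> rest \<longleftrightarrow> w \<in> rest"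
      using in_rest not_rest vw disj by (metis IntI emptyE)
    show "v = w"
    proof (cases "v \<in> rest")
      case True
      then show ?thesis
        using iff vw h(2) by (auto simp: f_def inj_on_def)
    next
      case False
      \<comment> \<open>A matched agent keeps its label, so equal images come from the same class,
        where \<open>g (q v)\<close> is injective.\<close>
      then have "q v = q w" "v \<in> G (q v)" "w \<in> G (q v)" "g (q v) v = g (q v) w"
        using not_rest[of v] not_rest[of w] vw iff by (auto simp: f_def)
      then show ?thesis
        using G(2) by (auto dest: inj_onD)
    qed
  qed
  moreover have "f ` ?U \<subseteq> V"
    using in_rest not_rest by blast
  ultimately obtain \<sigma> where \<sigma>: "\<sigma> permutes V" "\<And>v. v \<in> ?U \<Longrightarrow> \<sigma> v = f v"
    using inj_on_extend_permutes[of V ?U f] fin by blast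
  show thesis
  proof (rule that[OF \<sigma>(1)])
    fix v assume "v \<in> V" "q v \<in> B"
    then show "p (\<sigma> v) \<in> B"
      using in_rest[of v] \<sigma>(2)[of v] by (simp add: rest_def)
  next
    fix v assume "v \<in> V" "q v \<in> I"
    then show "p (\<sigma> v) = q v \<or> p (\<sigma> v) \<in> B"
      using in_rest[of v] not_rest[of v] \<sigma>(2)[of v] by auto
  qed
qed

section \<open>Shifts and the order on the values of \<open>chi\<close>\<close>

definition shifted_towards ::
  "'v set \<Rightarrow> 'x \<Rightarrow> 'x \<Rightarrow> ('v \<Rightarrow> 'x rel) \<Rightarrow> ('v \<Rightarrow> 'x rel) \<Rightarrow> bool" where
  "shifted_towards V a b Q P \<longleftrightarrow>
     (\<forall>v\<in>V. (prefers (Q v) a b \<longrightarrow> prefers (P v) a b) \<and>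
            (indifferent (Q v) a b \<longrightarrow> P v = Q v \<or> prefers (P v) a b))"

lemma preference_trichotomy:
  assumes "R \<in> preferences A" "a \<in> A" "b \<in> A"
  shows "prefers R a b \<or> indifferent R a b \<or> prefers R b a"
  using assms by (auto simp: preferences_def prefers_def indifferent_def)

text \<open>Reindexing along \<open>W\<close> replaces indices by preferences, and the positive part
  of an integer difference becomes truncated subtraction of naturals.\<close>

lemma chi_le_iff:
  assumes "finite V" "card V = n" "bij_betw W {1..\<tau>} I"
  shows "(chi V a b \<tau> W Q, chi V a b \<tau> W P) \<in> L_order n \<tau> \<longleftrightarrow>
    (\<Sum>R\<in>I. card (holders V R Q) - card (holders V R P)) + card (supporters V a b Q)
    \<le> card (supporters V a b P)"
proof -
  have "(\<Sum>i = 1..\<tau>. max (int (chi V a b \<tau> W Q i) - int (chi V a b \<tau> W P i)) 0)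
      = (\<Sum>i = 1..\<tau>. int (card (holders V (W i) Q) - card (holders V (W i) P)))"
    by (rule sum.cong) (auto simp: chi_def)
  also have "\<dots> = (\<Sum>R\<in>I. int (card (holders V R Q) - card (holders V R P)))"
    by (rule sum.reindex_bij_betw[OF assms(3)])
  also have "\<dots> = int (\<Sum>R\<in>I. card (holders V R Q) - card (holders V R P))"
    by simp
  finally have sum_eq: "(\<Sum>i = 1..\<tau>. max (int (chi V a b \<tau> W Q i) - int (chi V a b \<tau> W P i)) 0)
      = int (\<Sum>R\<in>I. card (holders V R Q) - card (holders V R P))" .
  have zero: "chi V a b \<tau> W X 0 = card (supporters V a b X)" for X
    by (simp add: chi_def)
  show ?thesis
    unfolding L_order_def mem_Collect_eq case_prod_conv sum_eq zero
    by (simp only: chi_in_L_set[OF assms(1,2)] simp_thms) linarith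
qed

text \<open>Agents who give up an indifferent preference become supporters of \<open>a\<close>; they
  are disjoint from the old supporters, who all remain.\<close>

lemma shifted_towards_chi_le:
  assumes fin: "finite V" "finite I" and I: "\<And>R. R \<in> I \<Longrightarrow> indifferent R a b"
    and shift: "shifted_towards V a b Q P"
  shows "(\<Sum>R\<in>I. card (holders V R Q) - card (holders V R P)) + card (supporters V a b Q)
    \<le> card (supporters V a b P)"
proof -
  let ?N = "\<Union>R\<in>I. holders V R Q - holders V R P"
  have finH: "finite (holders V R X)" "finite (supporters V a b X)" for R X
    using fin by (auto simp: holders_def supporters_def)
  have "(\<Sum>R\<in>I. card (holders V R Q) - card (holders V R P))
      \<le> (\<Sum>R\<in>I. card (holders V R Q - holders V R P))"
    by (intro sum_mono diff_card_le_card_Diff finH)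
  also have "\<dots> = card ?N"
    using fin finH by (intro card_UN_disjoint[symmetric]) (auto simp: holders_def)
  finally have "(\<Sum>R\<in>I. card (holders V R Q) - card (holders V R P)) + card (supporters V a b Q)
      \<le> card ?N + card (supporters V a b Q)"
    by simp
  also have "\<dots> = card (?N \<union> supporters V a b Q)"
    using fin finH I
    by (intro card_Un_disjoint[symmetric])
      (auto simp: holders_def supporters_def prefers_def indifferent_def)
  also have "\<dots> \<le> card (supporters V a b P)"
    using I shift
    by (intro card_mono finH) (auto simp: holders_def supporters_def shifted_towards_def)
  finally show ?thesis .
qed

section \<open>Strategy-proofness along shifts\<close>

lemma shifted_towards_strategy_proof:
  assumes pref: "\<W> \<subseteq> preferences A" and ab: "a \<in> A" "b \<in> A"
    and range: "\<phi> \<in> profiles V \<W> \<rightarrow> {a, b}"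
    and sp: "weakly_group_strategy_proof V \<W> \<phi>"
    and PQ: "P \<in> profiles V \<W>" "Q \<in> profiles V \<W>"
    and shift: "shifted_towards V a b Q P" and Q: "\<phi> Q = a"
  shows "\<phi> P = a"
proof (rule ccontr)
  assume "\<phi> P \<noteq> a"
  then have P: "\<phi> P = b" and neq: "a \<noteq> b"
    using range PQ by auto
  \<comment> \<open>The coalition consists of all agents whose preference changes; it is nonempty
    because profiles are extensional.\<close>
  have no_manipulation: False
    if "X \<in> profiles V \<W>" "Y \<in> profiles V \<W>" "\<phi> X \<noteq> \<phi> Y"
      "\<And>v. v \<in> V \<Longrightarrow> X v \<noteq> Y v \<Longrightarrow> prefers (X v) (\<phi> Y) (\<phi> X)" for X Y
  proof -
    let ?D = "{v \<in> V. X v \<noteq> Y v}"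
    have nonempty: "?D \<noteq> {}"
    proof
      assume "?D = {}"
      then have "X = Y"
        using that(1,2) unfolding profiles_def by (intro PiE_ext[of X]) auto
      with that(3) show False by simp
    qed
    show False
    proof (rule notE[OF sp[unfolded weakly_group_strategy_proof_def]], rule exI[of _ ?D], rule exI[of _ X], rule exI[of _ Y], intro conjI)
      show "?D \<noteq> {}" "X \<in> profiles V \<W>" "Y \<in> profiles V \<W>"
        by (rule nonempty that)+
      show "\<forall>v\<in>?D. prefers (X v) (\<phi> Y) (\<phi> X)"
        by (simp add: that(4))
    qed simp_all
  qed
  \<comment> \<open>The intermediate profile: only the agents supporting \<open>a\<close> in
    \<open>P\<close> have moved. If its outcome is \<open>b\<close>, they gain by going back to
    \<open>Q\<close>; if it is \<open>a\<close>, the remaining movers gain by going on to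
    \<open>P\<close>.\<close>
  define R where "R v = (if prefers (P v) a b then P v else Q v)" for v
  have R: "R \<in> profiles V \<W>"
    using PQ by (auto simp: profiles_def PiE_def extensional_def R_def)
  show False
  proof (cases "\<phi> R = a")
    case False
    then have b: "\<phi> R = b"
      using range R by auto
    have "prefers (R v) a b" if "R v \<noteq> Q v" for v
      using that by (auto simp: R_def split: if_splits)
    then show False
      using no_manipulation[of R Q] R PQ Q b neq by simp
  next
    case True
    \<comment> \<open>Such an agent still has \<open>Q v\<close> and does not support
      \<open>a\<close> in \<open>P\<close>; the shift then rules out support of \<open>a\<close> and
      indifference in \<open>Q\<close>.\<close>
    have "prefers (R v) b a" if "v \<in> V" "R v \<noteq> P v" for v
    proof -
      have "Q v \<in> preferences A"
        using PQ(2) pref that(1) by (auto simp: profiles_def)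
      then have "prefers (Q v) a b \<or> indifferent (Q v) a b \<or> prefers (Q v) b a"
        by (rule preference_trichotomy[OF _ ab])
      then show ?thesis
        using that shift by (auto simp: R_def shifted_towards_def split: if_splits)
    qed
    then show False
      using no_manipulation[of R P] R PQ True P neq by auto
  qed
qed

section \<open>The two implications between strategy-proofness with anonymity and
  monotonicity\<close>

theorem theorem4p3:
  fixes V :: "'v set" and A :: "'x set" and a b :: 'x
    and \<W> :: "'x rel set" and W :: "nat \<Rightarrow> 'x rel" and n \<tau> :: nat
    and \<phi> :: "('v \<Rightarrow> 'x rel) \<Rightarrow> 'x"
  assumes "finite V" and "card V = n"
    and "a \<in> A" and "b \<in> A" and "a \<noteq> b"
    and "\<W> \<subseteq> preferences A"
    and "finite {R \<in> \<W>. indifferent R a b}"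
    and "bij_betw W {1..\<tau>} {R \<in> \<W>. indifferent R a b}"
    and "\<phi> \<in> profiles V \<W> \<rightarrow> {a, b}"
  shows "weakly_group_strategy_proof V \<W> \<phi> \<and> anonymous V \<W> \<phi> \<longleftrightarrow>
    chi_monotone (profiles V \<W>) (L_order n \<tau>) (chi V a b \<tau> W) a \<phi>"
proof
  let ?I = "{R \<in> \<W>. indifferent R a b}"
  note chi_le = chi_le_iff[OF assms(1,2,8)]
  assume sp: "weakly_group_strategy_proof V \<W> \<phi> \<and> anonymous V \<W> \<phi>"
  show "chi_monotone (profiles V \<W>) (L_order n \<tau>) (chi V a b \<tau> W) a \<phi>"
    unfolding chi_monotone_def
  proof (intro ballI impI)
    fix P Q assume PQ: "P \<in> profiles V \<W>" "Q \<in> profiles V \<W>"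
      and "(chi V a b \<tau> W Q, chi V a b \<tau> W P) \<in> L_order n \<tau> \<and> \<phi> Q = a"
    then have le: "(chi V a b \<tau> W Q, chi V a b \<tau> W P) \<in> L_order n \<tau>" and Q: "\<phi> Q = a"
      by auto
    have "?I \<inter> {R. prefers R a b} = {}"
      by (auto simp: prefers_def indifferent_def)
    then obtain \<sigma> where \<sigma>: "\<sigma> permutes V"
      "\<And>v. v \<in> V \<Longrightarrow> prefers (Q v) a b \<Longrightarrow> prefers (P (\<sigma> v)) a b"
      "\<And>v. v \<in> V \<Longrightarrow> Q v \<in> ?I \<Longrightarrow> P (\<sigma> v) = Q v \<or> prefers (P (\<sigma> v)) a b"
      using exists_label_matching[OF assms(1,7), of "{R. prefers R a b}" Q P] le
      unfolding chi_le by (auto simp: holders_def supporters_def)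
    \<comment> \<open>This places every indifferent \<open>Q v\<close> in \<open>?I\<close>, where
      the matching applies.\<close>
    have "Q v \<in> \<W>" if "v \<in> V" for v
      using PQ(2) that by (auto simp: profiles_def)
    then have "shifted_towards V a b Q (P \<circ> \<sigma>)"
      using \<sigma> by (auto simp: shifted_towards_def)
    then have "\<phi> (P \<circ> \<sigma>) = a"
      using shifted_towards_strategy_proof[OF assms(6,3,4,9)] sp
        comp_permutes_profiles[OF PQ(1) \<sigma>(1)] PQ(2) Q by blast
    then show "\<phi> P = a"
      using sp PQ(1) \<sigma>(1) by (auto simp: anonymous_def)
  qed
next
  let ?I = "{R \<in> \<W>. indifferent R a b}"
  assume mono: "chi_monotone (profiles V \<W>) (L_order n \<tau>) (chi V a b \<tau> W) a \<phi>"
  have shift_mono: "\<phi> P = a"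
    if "P \<in> profiles V \<W>" "Q \<in> profiles V \<W>" "shifted_towards V a b Q P" "\<phi> Q = a" for P Q
  proof -
    have "(chi V a b \<tau> W Q, chi V a b \<tau> W P) \<in> L_order n \<tau>"
      unfolding chi_le_iff[OF assms(1,2,8)]
      using that(3) by (intro shifted_towards_chi_le assms(1,7)) auto
    then show ?thesis
      using mono that by (auto simp: chi_monotone_def)
  qed
  have "weakly_group_strategy_proof V \<W> \<phi>"
    unfolding weakly_group_strategy_proof_def
  proof (rule notI, elim exE conjE)
    fix D P Q
    assume D: "D \<noteq> {}" "D \<subseteq> V" and PQ: "P \<in> profiles V \<W>" "Q \<in> profiles V \<W>"
      and eq: "\<forall>v\<in>V - D. P v = Q v" and gain: "\<forall>v\<in>D. prefers (P v) (\<phi> Q) (\<phi> P)"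
    have "\<phi> P \<noteq> \<phi> Q"
      using D gain by (auto simp: prefers_def)
    moreover have "\<phi> P \<in> {a, b}" "\<phi> Q \<in> {a, b}"
      using assms(9) PQ by auto
    ultimately consider "\<phi> P = a" "\<phi> Q = b" | "\<phi> P = b" "\<phi> Q = a"
      by auto
    then show False
    proof cases
      case 1
      \<comment> \<open>Deviators strictly prefer \<open>b\<close> in \<open>P\<close>, and a shift
        leaves such agents free.\<close>
      have "shifted_towards V a b P Q"
        unfolding shifted_towards_def
      proof
        fix v assume "v \<in> V"
        then show "(prefers (P v) a b \<longrightarrow> prefers (Q v) a b) \<and>
            (indifferent (P v) a b \<longrightarrow> Q v = P v \<or> prefers (Q v) a b)"
          using gain eq 1 by (cases "v \<in> D") (auto simp: prefers_def indifferent_def)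
      qed
      from shift_mono[OF PQ(2,1) this 1(1)] show False
        using 1 assms(5) by simp
    next
      case 2
      \<comment> \<open>Here deviators support \<open>a\<close> in \<open>P\<close>, so the shift
        runs the other way.\<close>
      have "shifted_towards V a b Q P"
        unfolding shifted_towards_def
      proof
        fix v assume "v \<in> V"
        then show "(prefers (Q v) a b \<longrightarrow> prefers (P v) a b) \<and>
            (indifferent (Q v) a b \<longrightarrow> P v = Q v \<or> prefers (P v) a b)"
          using gain eq 2 by (cases "v \<in> D") auto
      qed
      from shift_mono[OF PQ this 2(2)] show False
        using 2 assms(5) by simp
    qed
  qed
  moreover have "anonymous V \<W> \<phi>"
    unfolding anonymous_def
  proof (intro ballI allI impI)
    fix P \<sigma> assume P: "P \<in> profiles V \<W>" and \<sigma>: "\<sigma> permutes V"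
    have P\<sigma>: "P \<circ> \<sigma> \<in> profiles V \<W>"
      using P \<sigma> by (rule comp_permutes_profiles)
    have card_eq: "card {v \<in> V. C (P (\<sigma> v))} = card {v \<in> V. C (P v)}" for C
    proof (rule bij_betw_same_card[of \<sigma>])
      have "\<sigma> ` {v \<in> V. C (P (\<sigma> v))} = \<sigma> ` V \<inter> {v. C (P v)}"
        by auto
      also have "\<dots> = {v \<in> V. C (P v)}"
        using permutes_image[OF \<sigma>] by auto
      finally show "bij_betw \<sigma> {v \<in> V. C (P (\<sigma> v))} {v \<in> V. C (P v)}"
        using permutes_inj_on[OF \<sigma>] by (simp add: bij_betw_def)
    qed
    have "chi V a b \<tau> W (P \<circ> \<sigma>) = chi V a b \<tau> W P"
      using card_eq[of "\<lambda>R. prefers R a b"] card_eq[of "\<lambda>R. R = W i" for i]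
      by (auto simp: chi_def supporters_def holders_def fun_eq_iff)
    \<comment> \<open>By reflexivity the two profiles are comparable in both directions, so
      monotonicity yields an equivalence.\<close>
    moreover have "(chi V a b \<tau> W P, chi V a b \<tau> W P) \<in> L_order n \<tau>"
      by (simp add: chi_le_iff[OF assms(1,2,8)])
    ultimately have "\<phi> (P \<circ> \<sigma>) = a \<longleftrightarrow> \<phi> P = a"
      using mono P P\<sigma> unfolding chi_monotone_def by metis
    moreover have "\<phi> P \<in> {a, b}" "\<phi> (P \<circ> \<sigma>) \<in> {a, b}"
      using assms(9) P P\<sigma> by auto
    ultimately show "\<phi> P = \<phi> (P \<circ> \<sigma>)"
      by auto
  qed
  ultimately show "weakly_group_strategy_proof V \<W> \<phi> \<and> anonymous V \<W> \<phi>"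
    by blast
qed

end
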